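(* Let $G$ be a nontrivial finite abelian group and let $n\ge1$. Let $I_{G,n}$ be the cellular automaton over the alphabet $\mathcal A=G^2$ defined by $$I_{G,n}(c)_z=\bigl(-[\pi_1(c_{z-n})+\pi_1(c_{z+n})+\pi_2(c_z)],\ \pi_1(c_z)\bigr)\qquad (c\in\mathcal A^{\mathbb Z},\ z\in\mathbb Z).$$ Then $I_{G,n}$ randomizes cylinders of length $n$, but does not randomize cylinders of length $n+1$ (the class of initial measures being the harmonically mixing measures on $\mathcal A^{\mathbb Z}$).
   Context: $\pi_1,\pi_2:G^2\to G$ are the coordinate projections. For a word $u\in\mathcal A^m$ and $k\in\mathbb Z$, $[u]_k=\{x\in\mathcal A^{\mathbb Z}: x_k\cdots x_{k+m-1}=u\}$. For a Borel probability measure $\mu$ on $\mathcal A^{\mathbb Z}$, $F\mu(U)=\mu(F^{-1}U)$. $F$ randomizes cylinders of length $m$ if for every harmonically mixing $\mu$, every $u\in\mathcal A^m$ and every $k\in\mathbb Z$, $F^t\mu([u]_k)\to|\mathcal A|^{-m}$ as $t\to\infty$. A character of $\mathcal A^{\mathbb Z}$ is a continuous group homomorphism $\chi$ to the unit circle, written uniquely $\chi(x)=\prod_{k}\chi_k(x_k)$ with $\chi_k$ characters of $\mathcal A$, all but finitely many trivial; $\mathrm{rank}(\chi)=|\{k:\chi_k\ne\mathbf 1\}|$. $\mu$ is harmonically mixing if for all $\varepsilon>0$ there is $R>0$ such that $\mathrm{rank}(\chi)>R$ implies $\left|\int\chi\,d\mu\right|<\varepsilon$. *)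

theory Defs
  imports "HOL-Probability.Probability"
begin

text \<open>
  The alphabet is a finite type carrying an abelian group structure; on a product type the
  group operations are the componentwise ones. Configurations are functions on the integers,
  with the product of the discrete topologies, and all measures live on the Borel
  sigma-algebra of that topology.
\<close>

definition config_topology :: "(int \<Rightarrow> 'a) topology" where
  "config_topology = product_topology (\<lambda>_. discrete_topology UNIV) UNIV"

definition config_borel :: "(int \<Rightarrow> 'a) measure" where
  "config_borel = sigma UNIV {U. openin config_topology U}"

definition config_prob :: "(int \<Rightarrow> 'a) measure \<Rightarrow> bool" where
  "config_prob \<mu> \<longleftrightarrow> prob_space \<mu> \<and> sets \<mu> = sets config_borel"

definition cylinder :: "int \<Rightarrow> 'a list \<Rightarrow> (int \<Rightarrow> 'a) set" where
  "cylinder k u = {x. \<forall>i<length u. x (k + int i) = u ! i}"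


definition letter_character :: "('a::ab_group_add \<Rightarrow> complex) \<Rightarrow> bool" where
  "letter_character \<phi> \<longleftrightarrow> range \<phi> \<subseteq> sphere 0 1 \<and> (\<forall>a b. \<phi> (a + b) = \<phi> a * \<phi> b)"

definition config_character :: "((int \<Rightarrow> 'a::ab_group_add) \<Rightarrow> complex) \<Rightarrow> bool" where
  "config_character \<xi> \<longleftrightarrow>
     continuous_map config_topology euclidean \<xi> \<and>
     range \<xi> \<subseteq> sphere 0 1 \<and>
     (\<forall>x y. \<xi> (\<lambda>k. x k + y k) = \<xi> x * \<xi> y)"

definition character_support :: "(int \<Rightarrow> 'a \<Rightarrow> complex) \<Rightarrow> int set" where
  "character_support \<phi> = {k. \<phi> k \<noteq> (\<lambda>_. 1)}"

definition character_factors ::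
    "((int \<Rightarrow> 'a::ab_group_add) \<Rightarrow> complex) \<Rightarrow> (int \<Rightarrow> 'a \<Rightarrow> complex) \<Rightarrow> bool" where
  "character_factors \<xi> \<phi> \<longleftrightarrow>
     (\<forall>k. letter_character (\<phi> k)) \<and>
     finite (character_support \<phi>) \<and>
     (\<forall>x. \<xi> x = (\<Prod>k\<in>character_support \<phi>. \<phi> k (x k)))"

text \<open>The description is proper on characters, by \<open>config_character_ex1_factors\<close> below.\<close>

definition character_rank :: "((int \<Rightarrow> 'a::ab_group_add) \<Rightarrow> complex) \<Rightarrow> nat" where
  "character_rank \<xi> = card (character_support (THE \<phi>. character_factors \<xi> \<phi>))"

definition harmonically_mixing :: "(int \<Rightarrow> 'a::ab_group_add) measure \<Rightarrow> bool" where
  "harmonically_mixing \<mu> \<longleftrightarrow>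
     (\<forall>\<epsilon>>0. \<exists>R>0::real. \<forall>\<xi>. config_character \<xi> \<longrightarrow> real (character_rank \<xi>) > R \<longrightarrow>
        cmod (\<integral>x. \<xi> x \<partial>\<mu>) < \<epsilon>)"

definition randomizes_cylinders ::
    "((int \<Rightarrow> 'a::{finite,ab_group_add}) \<Rightarrow> (int \<Rightarrow> 'a)) \<Rightarrow> nat \<Rightarrow> bool" where
  "randomizes_cylinders F m \<longleftrightarrow>
     (\<forall>\<mu>. config_prob \<mu> \<longrightarrow> harmonically_mixing \<mu> \<longrightarrow>
        (\<forall>u k. length u = m \<longrightarrow>
           (\<lambda>t. measure (distr \<mu> config_borel (F ^^ t)) (cylinder k u))
             \<longlonglongrightarrow> 1 / real CARD('a) ^ m))"

definition I_CA :: "nat \<Rightarrow> (int \<Rightarrow> 'g \<times> 'g) \<Rightarrow> (int \<Rightarrow> 'g \<times> 'g::ab_group_add)" where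
  "I_CA n c = (\<lambda>z. (- (fst (c (z - int n)) + fst (c (z + int n)) + snd (c z)), fst (c z)))"


lemma topspace_config [simp]: "topspace config_topology = UNIV"
  by (simp add: config_topology_def)

lemma letter_character_0: "letter_character \<phi> \<Longrightarrow> \<phi> 0 = 1"
proof -
  assume a: "letter_character \<phi>"
  have "\<phi> 0 = \<phi> 0 * \<phi> 0"
    using a unfolding letter_character_def by (metis add_0)
  moreover have "\<phi> 0 \<noteq> 0"
  proof -
    have "\<phi> 0 \<in> sphere 0 1"
      using a unfolding letter_character_def by blast
    then show ?thesis by auto
  qed
  ultimately show ?thesis by simp
qed

lemma config_character_norm: "config_character \<xi> \<Longrightarrow> cmod (\<xi> x) = 1"
  unfolding config_character_def by fastforce

lemma config_character_add:
  "config_character \<xi> \<Longrightarrow> \<xi> (\<lambda>k. x k + y k) = \<xi> x * \<xi> y"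
  unfolding config_character_def by blast

lemma config_character_0: "config_character \<xi> \<Longrightarrow> \<xi> (\<lambda>_. 0) = 1"
proof -
  assume a: "config_character \<xi>"
  have "\<xi> (\<lambda>_. 0) = \<xi> (\<lambda>_. 0) * \<xi> (\<lambda>_. 0)"
    using config_character_add[OF a, of "\<lambda>_. 0" "\<lambda>_. 0"] by simp
  moreover have "\<xi> (\<lambda>_. 0) \<noteq> 0"
    using config_character_norm[OF a, of "\<lambda>_. 0"] by auto
  ultimately show ?thesis by simp
qed

lemma power_Re_gt_half_eq_1:
  fixes z :: complex
  assumes "cmod z = 1" and *: "\<And>m. Re (z ^ m) > 1/2"
  shows "z = 1"
proof (rule ccontr)
  assume "z \<noteq> 1"
  then have pos: "cmod (z - 1) > 0" by simp
  obtain M :: nat where M: "real M > 4 / cmod (z - 1)"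
    using reals_Archimedean2 by blast
  have "real M / 2 = (\<Sum>m<M. 1/2 :: real)" by simp
  also have "\<dots> \<le> (\<Sum>m<M. Re (z ^ m))"
    by (intro sum_mono less_imp_le *)
  also have "\<dots> = Re (\<Sum>m<M. z ^ m)" by simp
  also have "\<dots> \<le> cmod (\<Sum>m<M. z ^ m)" by (rule complex_Re_le_cmod)
  also have "\<dots> = cmod (z ^ M - 1) / cmod (z - 1)"
    using \<open>z \<noteq> 1\<close> by (simp add: geometric_sum norm_divide)
  also have "\<dots> \<le> 2 / cmod (z - 1)"
  proof (rule divide_right_mono)
    show "cmod (z ^ M - 1) \<le> 2"
      using norm_triangle_ineq4[of "z ^ M" 1] assms(1) by (simp add: norm_power)
  qed simp
  finally show False using M by simp
qed

lemma config_character_finite_dependence: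
  assumes \<xi>: "config_character (\<xi> :: (int \<Rightarrow> 'a::ab_group_add) \<Rightarrow> complex)"
  obtains S where "finite S" "\<And>x. (\<And>k. k \<in> S \<Longrightarrow> x k = 0) \<Longrightarrow> \<xi> x = 1"
proof -
  define W where "W = {x. Re (\<xi> x) > 1/2}"
  have "openin config_topology {x \<in> topspace config_topology. \<xi> x \<in> {z. Re z > 1/2}}"
  proof (rule openin_continuous_map_preimage)
    show "continuous_map config_topology euclidean \<xi>"
      using \<xi> unfolding config_character_def by blast
    show "openin euclidean {z. Re z > 1/2}"
      using open_halfspace_Re_gt[of "1/2"] by simp
  qed
  then have "openin config_topology W" by (simp add: W_def)
  moreover have "(\<lambda>_. 0) \<in> W" using config_character_0[OF \<xi>] by (simp add: W_def)
  ultimately obtain X where X: "(\<lambda>_. 0) \<in> Pi\<^sub>E UNIV X" "finite {i. X i \<noteq> (UNIV :: 'a set)}"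
      "Pi\<^sub>E UNIV X \<subseteq> W"
    using product_topology_open_contains_basis[of "\<lambda>_. discrete_topology UNIV" UNIV W "\<lambda>_. 0"]
    unfolding config_topology_def by auto
  show thesis
  proof
    show "finite {i. X i \<noteq> UNIV}" by fact
    fix x :: "int \<Rightarrow> 'a" assume x: "\<And>k. k \<in> {i. X i \<noteq> UNIV} \<Longrightarrow> x k = 0"
    have "\<exists>y. (\<forall>k. k \<in> {i. X i \<noteq> UNIV} \<longrightarrow> y k = 0) \<and> \<xi> y = \<xi> x ^ m" for m
    proof (induction m)
      case 0
      show ?case using config_character_0[OF \<xi>] by (intro exI[of _ "\<lambda>_. 0"]) simp
    next
      case (Suc m)
      then obtain y where "\<forall>k. k \<in> {i. X i \<noteq> UNIV} \<longrightarrow> y k = 0" "\<xi> y = \<xi> x ^ m" by blast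
      then show ?case using x config_character_add[OF \<xi>, of x y]
        by (intro exI[of _ "\<lambda>k. x k + y k"]) simp
    qed
    moreover have "y \<in> W" if "\<forall>k. k \<in> {i. X i \<noteq> UNIV} \<longrightarrow> y k = 0" for y
    proof -
      have "y k \<in> X k" for k
        using that X(1) by (cases "X k = UNIV") (auto simp: PiE_def Pi_def)
      then show ?thesis using X(3) by (auto simp: PiE_def Pi_def)
    qed
    ultimately have "Re (\<xi> x ^ m) > 1/2" for m
      unfolding W_def by (metis mem_Collect_eq)
    then show "\<xi> x = 1"
      by (intro power_Re_gt_half_eq_1 config_character_norm[OF \<xi>])
  qed
qed

lemma character_factors_single:
  assumes "character_factors \<xi> \<phi>"
  shows "\<phi> k a = \<xi> (\<lambda>j. if j = k then a else 0)"
proof -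
  have fin: "finite (character_support \<phi>)" and l: "\<And>k. letter_character (\<phi> k)"
    using assms by (auto simp: character_factors_def)
  have "\<xi> (\<lambda>j. if j = k then a else 0)
      = (\<Prod>j\<in>character_support \<phi>. \<phi> j (if j = k then a else 0))"
    using assms by (simp add: character_factors_def)
  also have "\<dots> = (\<Prod>j\<in>character_support \<phi>. if j = k then \<phi> k a else 1)"
    by (intro prod.cong) (auto simp: letter_character_0[OF l])
  also have "\<dots> = \<phi> k a"
    using fin by (auto simp: prod.delta character_support_def)
  finally show ?thesis by simp
qed

lemma config_character_ex1_factors:
  assumes \<xi>: "config_character (\<xi> :: (int \<Rightarrow> 'a::ab_group_add) \<Rightarrow> complex)"
  shows "\<exists>!\<phi>. character_factors \<xi> \<phi>"
proof (rule ex_ex1I)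
  define \<phi> where "\<phi> = (\<lambda>k a. \<xi> (\<lambda>j. if j = k then a else 0))"
  obtain S where S: "finite S" "\<And>x. (\<And>k. k \<in> S \<Longrightarrow> x k = 0) \<Longrightarrow> \<xi> x = 1"
    using config_character_finite_dependence[OF \<xi>] by blast
  have sub: "character_support \<phi> \<subseteq> S"
  proof
    fix k assume "k \<in> character_support \<phi>"
    then obtain a where "\<phi> k a \<noteq> 1" by (auto simp: character_support_def)
    then show "k \<in> S" using S(2)[of "\<lambda>j. if j = k then a else 0"]
      unfolding \<phi>_def by (metis (no_types, lifting))
  qed
  have "letter_character (\<phi> k)" for k
    unfolding letter_character_def
  proof (intro conjI allI)
    show "range (\<phi> k) \<subseteq> sphere 0 1"
      using config_character_norm[OF \<xi>] by (auto simp: \<phi>_def)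
    fix a b :: 'a
    have "(\<lambda>j. if j = k then a + b else 0)
        = (\<lambda>j. (if j = k then a else 0) + (if j = k then b else 0))" for k :: int
      by (auto simp: fun_eq_iff)
    then show "\<phi> k (a + b) = \<phi> k a * \<phi> k b"
      using config_character_add[OF \<xi>] by (simp add: \<phi>_def)
  qed
  moreover have "\<xi> x = (\<Prod>k\<in>character_support \<phi>. \<phi> k (x k))" for x
  proof -
    have restr: "\<xi> (\<lambda>k. if k \<in> T then x k else 0) = (\<Prod>k\<in>T. \<phi> k (x k))" if "finite T" for T
      using that
    proof (induction T)
      case empty
      show ?case using config_character_0[OF \<xi>] by simp
    next
      case (insert t T)
      have "(\<lambda>k. if k \<in> insert t T then x k else 0)
          = (\<lambda>k. (if k = t then x t else 0) + (if k \<in> T then x k else 0))"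
        using insert by auto
      then show ?case using insert config_character_add[OF \<xi>] by (simp add: \<phi>_def)
    qed
    have "x = (\<lambda>k. (if k \<in> S then x k else 0) + (if k \<in> S then 0 else x k))" by auto
    then have "\<xi> x = \<xi> (\<lambda>k. if k \<in> S then x k else 0) * \<xi> (\<lambda>k. if k \<in> S then 0 else x k)"
      using config_character_add[OF \<xi>] by metis
    also have "\<xi> (\<lambda>k. if k \<in> S then 0 else x k) = 1"
      by (rule S(2)) simp
    also have "\<xi> (\<lambda>k. if k \<in> S then x k else 0) = (\<Prod>k\<in>S. \<phi> k (x k))"
      by (rule restr) fact
    also have "\<dots> = (\<Prod>k\<in>character_support \<phi>. \<phi> k (x k))"
      using S(1) sub by (intro prod.mono_neutral_right) (auto simp: character_support_def)
    finally show ?thesis by simp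
  qed
  ultimately have "character_factors \<xi> \<phi>"
    using S(1) sub by (auto simp: character_factors_def intro: finite_subset)
  then show "\<exists>\<phi>. character_factors \<xi> \<phi>" by blast
next
  show "\<phi> = \<psi>" if "character_factors \<xi> \<phi>" "character_factors \<xi> \<psi>" for \<phi> \<psi>
    using character_factors_single that by (metis ext)
qed

lemma continuous_map_I_CA:
  "continuous_map config_topology config_topology
     (I_CA n :: (int \<Rightarrow> 'a \<times> 'a::ab_group_add) \<Rightarrow> (int \<Rightarrow> 'a \<times> 'a))"
proof -
  have proj: "continuous_map config_topology (discrete_topology UNIV) (\<lambda>c :: int \<Rightarrow> 'a \<times> 'a. c z)" for z
    unfolding config_topology_def by (rule continuous_map_product_projection) simp
  have op: "openin config_topology {c. c z \<in> B}" for z :: int and B :: "('a \<times> 'a) set"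
    using openin_continuous_map_preimage[OF proj, of B z] by simp
  have "continuous_map config_topology (discrete_topology UNIV) (\<lambda>c :: int \<Rightarrow> 'a \<times> 'a. I_CA n c z)" for z
    unfolding continuous_map_def
  proof (intro conjI allI impI)
    fix U :: "('a \<times> 'a) set"
    have eq: "{c \<in> topspace config_topology. I_CA n c z \<in> U}
        = (\<Union>(a, b, d) \<in> {(a, b, d). (- (fst a + fst b + snd d), fst d) \<in> U}.
            {c. c (z - int n) \<in> {a}} \<inter> {c. c (z + int n) \<in> {b}} \<inter> {c. c z \<in> {d}})"
      by (auto simp: I_CA_def)
    show "openin config_topology {c \<in> topspace config_topology. I_CA n c z \<in> U}"
      unfolding eq by (rule openin_Union, clarify, intro openin_Int op)
  qed auto
  then show ?thesis
    by (subst (2) config_topology_def) (simp add: continuous_map_componentwise)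
qed

lemma space_config_borel [simp]: "space config_borel = UNIV"
  by (simp add: config_borel_def)

lemma sets_config_borel: "sets config_borel = sigma_sets UNIV {U. openin config_topology U}"
  by (simp add: config_borel_def)

lemma measurable_config_borel:
  assumes "continuous_map config_topology config_topology F"
  shows "F \<in> config_borel \<rightarrow>\<^sub>M config_borel"
proof -
  have "F -` U \<in> sets config_borel" if "openin config_topology U" for U
    using openin_continuous_map_preimage[OF assms that]
    by (auto simp: sets_config_borel vimage_def)
  then have "F \<in> config_borel \<rightarrow>\<^sub>M sigma UNIV {U. openin config_topology U}"
    by (intro measurable_sigma_sets[where \<Omega> = UNIV and A = "{U. openin config_topology U}"]) auto
  then show ?thesis by (simp add: config_borel_def)
qed

lemma cylinder_in_sets: "cylinder k (u :: 'a list) \<in> sets config_borel"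
proof -
  have "continuous_map config_topology (discrete_topology UNIV) (\<lambda>x :: int \<Rightarrow> 'a. x j)" for j
    unfolding config_topology_def by (rule continuous_map_product_projection) simp
  from openin_continuous_map_preimage[OF this, of "{a}" j for a j]
  have "openin config_topology {x. x j = a}" for j :: int and a :: 'a
    by simp
  then have "{x. x (k + int i) = u ! i} \<in> sets config_borel" for i
    by (auto simp: sets_config_borel)
  then have "{x \<in> space config_borel. \<forall>i\<in>{..<length u}. x (k + int i) = u ! i} \<in> sets config_borel"
    by (intro sets.sets_Collect_finite_All) auto
  then show ?thesis by (simp add: cylinder_def Ball_def)
qed

lemma I_CA_shift: "I_CA n (\<lambda>z. c (z + s)) = (\<lambda>z. I_CA n c (z + s))"
  by (simp add: I_CA_def algebra_simps)

end

theory Submission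
  imports Defs
begin

text \<open>
  Writing \<open>a\<^sub>t\<close> for the first component at time \<open>t\<close>, the automaton is the second-order recurrence
  \<open>a\<^sub>t\<^sub>+\<^sub>1 + (\<sigma> + \<sigma>\<inverse>) a\<^sub>t + a\<^sub>t\<^sub>-\<^sub>1 = 0\<close> with \<open>\<sigma>\<close> the shift by \<open>n\<close>; the second component is \<open>a\<^sub>t\<^sub>-\<^sub>1\<close>.

  A character of a window of length \<open>n\<close> sees at most one site of each coset of \<open>n\<int>\<close>. The influence
  of a single letter spreads over its coset without gaps and without losing information, so such a
  character, when nontrivial, pulls back under \<open>t + 1\<close> steps to one of rank at least \<open>t\<close>. Harmonic
  mixing sends its integral to \<open>0\<close>, and Fourier inversion on the finite alphabet gives the limit
  of cylinder probabilities.

  The characteristic polynomial \<open>X\<^sup>2 + (\<sigma> + \<sigma>\<inverse>) X + 1 = (X + \<sigma>) (X + \<sigma>\<inverse>)\<close> splits, so the quantity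
  \<open>a\<^sub>t + \<sigma> a\<^sub>t\<^sub>-\<^sub>1\<close> is merely translated and negated at each step. It is read off a window of length
  \<open>n + 1\<close>, and for independent letters that are \<open>0\<close> with probability one half and uniform otherwise
  its nontrivial characters keep the integral \<open>1/4\<close> for ever.
\<close>

subsection \<open>Characters of a finite abelian group\<close>

primrec nat_mult :: "nat \<Rightarrow> 'a::ab_group_add \<Rightarrow> 'a" where
  "nat_mult 0 y = 0"
| "nat_mult (Suc i) y = y + nat_mult i y"

lemma nat_mult_add: "nat_mult (i + j) y = nat_mult i y + nat_mult j y"
  by (induction i) (auto simp: add_ac)

lemma nat_mult_mult: "nat_mult (i * j) y = nat_mult i (nat_mult j y)"
  by (induction i) (auto simp: nat_mult_add)

text \<open>Pigeonhole: two multiples of \<open>y\<close> coincide, and the difference of their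
  indices annihilates \<open>y\<close>.\<close>

lemma ex_nat_mult_eq_0: "\<exists>N>0. nat_mult N (y :: 'a::{finite,ab_group_add}) = 0"
proof -
  have "\<not> inj (\<lambda>i. nat_mult i y)"
    using finite_imageD[of "\<lambda>i. nat_mult i y" UNIV] finite[of "range (\<lambda>i. nat_mult i y)"] by auto
  then obtain i j where "i < j" "nat_mult i y = nat_mult j y"
    unfolding inj_def by (metis linorder_neqE_nat)
  then have "nat_mult (j - i) y = 0"
    using nat_mult_add[of i "j - i" y] by simp
  then show ?thesis using \<open>i < j\<close> by (intro exI[of _ "j - i"]) simp
qed

text \<open>Over a finite group this says that \<open>K\<close> is a subgroup and
  \<open>\<eta>\<close> a homomorphism from it to the unit circle: negatives are multiples, and the
  values on \<open>K\<close> are roots of unity.\<close>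

definition partial_character :: "'a::ab_group_add set \<Rightarrow> ('a \<Rightarrow> complex) \<Rightarrow> bool" where
  "partial_character K \<eta> \<longleftrightarrow>
     0 \<in> K \<and> \<eta> 0 = 1 \<and> (\<forall>a\<in>K. \<forall>b\<in>K. a + b \<in> K \<and> \<eta> (a + b) = \<eta> a * \<eta> b)"

lemma partial_character_nat_mult:
  assumes "partial_character K \<eta>" "a \<in> K"
  shows "nat_mult i a \<in> K \<and> \<eta> (nat_mult i a) = \<eta> a ^ i"
  using assms by (induction i) (auto simp: partial_character_def)

text \<open>If \<open>N\<close> annihilates \<open>b\<close>, then \<open>-b\<close> is the multiple
  \<open>N - 1\<close> of \<open>b\<close>, so closure under addition gives closure under
  subtraction.\<close>

lemma partial_character_diff:
  assumes "partial_character K \<eta>" "a \<in> K" "b \<in> (K :: 'a::{finite,ab_group_add} set)"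
  shows "a - b \<in> K"
proof -
  obtain N where "N > 0" "nat_mult N b = 0"
    using ex_nat_mult_eq_0 by blast
  then have "b + nat_mult (N - 1) b = 0"
    by (cases N) auto
  then have "a - b = a + nat_mult (N - 1) b"
    using minus_unique[of b "nat_mult (N - 1) b"] by simp
  moreover have "a + nat_mult (N - 1) b \<in> K"
    using assms(1,2) partial_character_nat_mult[OF assms(1,3)] by (simp add: partial_character_def)
  ultimately show ?thesis by (simp only:)
qed

text \<open>The extension to the subgroup generated by \<open>K\<close> and \<open>y\<close> sends
  \<open>k + i y\<close> to \<open>\<eta> k * c ^ i\<close>. Since \<open>m\<close> is the order of
  \<open>y\<close> modulo \<open>K\<close>, the condition on \<open>c ^ m\<close> settles every
  relation between \<open>y\<close> and \<open>K\<close>. The prescribed value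
  \<open>\<psi> y = c\<close> is recorded because separating points depends on choosing it.\<close>

lemma partial_character_extend_step:
  fixes K :: "'a::{finite,ab_group_add} set"
  assumes pc: "partial_character K \<eta>"
    and m: "m > 0" "nat_mult m y \<in> K" "\<And>i. 0 < i \<Longrightarrow> i < m \<Longrightarrow> nat_mult i y \<notin> K"
    and c: "c ^ m = \<eta> (nat_mult m y)"
  obtains L \<psi> where "partial_character L \<psi>" "K \<subseteq> L" "y \<in> L" "\<psi> y = c" "\<And>k. k \<in> K \<Longrightarrow> \<psi> k = \<eta> k"
proof -
  \<comment> \<open>Two representations of one element differ by \<open>d y\<close> in
    \<open>K\<close>; subtracting a multiple of \<open>m y\<close> leaves \<open>(d mod m) y\<close>
    in \<open>K\<close>, so minimality of \<open>m\<close> forces \<open>m\<close> to divide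
    \<open>d\<close>.\<close>
  have wd: "\<eta> k * c ^ i = \<eta> l * c ^ j"
    if "k \<in> K" "l \<in> K" "k + nat_mult i y = l + nat_mult j y" "i \<le> j" for k l i j
  proof -
    define d where "d = j - i"
    have d: "k = l + nat_mult d y" "j = i + d"
      using that nat_mult_add[of i d y] by (auto simp: d_def algebra_simps)
    have "nat_mult d y \<in> K"
      using partial_character_diff[OF pc that(1,2)] d by simp
    moreover have eq: "nat_mult d y = nat_mult (d div m) (nat_mult m y) + nat_mult (d mod m) y"
      using nat_mult_add[of "d div m * m" "d mod m" y] by (simp add: nat_mult_mult)
    moreover have q: "nat_mult (d div m) (nat_mult m y) \<in> K"
        "\<eta> (nat_mult (d div m) (nat_mult m y)) = \<eta> (nat_mult m y) ^ (d div m)"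
      using partial_character_nat_mult[OF pc m(2)] by auto
    ultimately have "nat_mult (d mod m) y \<in> K"
      using partial_character_diff[OF pc, of "nat_mult d y" "nat_mult (d div m) (nat_mult m y)"]
      by simp
    then have "d mod m = 0" using m(1) m(3)[of "d mod m"] by force
    then have "\<eta> k = \<eta> l * \<eta> (nat_mult m y) ^ (d div m)" and "d = m * (d div m)"
      using q that d eq pc by (auto simp: partial_character_def)
    moreover have "c ^ (m * (d div m)) = \<eta> (nat_mult m y) ^ (d div m)"
      using c by (simp add: power_mult)
    ultimately show ?thesis using d(2) by (simp add: power_add)
  qed
  \<comment> \<open>An element has many representations \<open>k + i y\<close>; by \<open>wd\<close>
    the value does not depend on the one chosen.\<close>
  define \<psi> where "\<psi> x = (SOME w. \<exists>k\<in>K. \<exists>i. x = k + nat_mult i y \<and> w = \<eta> k * c ^ i)" for x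
  have \<psi>: "\<psi> (k + nat_mult i y) = \<eta> k * c ^ i" if "k \<in> K" for k i
    unfolding \<psi>_def
  proof (rule someI2_ex)
    fix w assume "\<exists>l\<in>K. \<exists>j. k + nat_mult i y = l + nat_mult j y \<and> w = \<eta> l * c ^ j"
    then show "w = \<eta> k * c ^ i" using wd that by (metis nat_le_linear)
  qed (use that in blast)
  define L where "L = {k + nat_mult i y |k i. k \<in> K}"
  have K0: "0 \<in> K" "\<eta> 0 = 1" using pc by (auto simp: partial_character_def)
  have LI: "k + nat_mult i y \<in> L" if "k \<in> K" for k i
    using that by (auto simp: L_def)
  show thesis
  proof (rule that[of L \<psi>])
    show k: "\<psi> k = \<eta> k" if "k \<in> K" for k using \<psi>[OF that, of 0] by simp
    show "K \<subseteq> L" using LI[of _ 0] by auto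
    show "y \<in> L" using LI[OF K0(1), of 1] by simp
    show "\<psi> y = c" using \<psi>[OF K0(1), of 1] K0 by simp
    have "a + b \<in> L \<and> \<psi> (a + b) = \<psi> a * \<psi> b" if ab: "a \<in> L" "b \<in> L" for a b
    proof -
      obtain k i l j where *: "k \<in> K" "a = k + nat_mult i y" "l \<in> K" "b = l + nat_mult j y"
        using ab unfolding L_def by blast
      then have kl: "k + l \<in> K" "\<eta> (k + l) = \<eta> k * \<eta> l"
        using pc by (auto simp: partial_character_def)
      have eq: "a + b = (k + l) + nat_mult (i + j) y"
        by (simp add: * nat_mult_add algebra_simps)
      have "\<psi> (a + b) = \<psi> a * \<psi> b"
        unfolding eq \<psi>[OF kl(1)] by (simp add: kl(2) *(2,4) \<psi>[OF *(1)] \<psi>[OF *(3)] power_add)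
      then show ?thesis using LI[OF kl(1)] eq by simp
    qed
    then show "partial_character L \<psi>"
      using LI[OF K0(1), of 0] k[OF K0(1)] K0 by (simp add: partial_character_def)
  qed
qed

lemma ex_least_multiple:
  assumes "partial_character K \<eta>"
  obtains m where "m > 0" "nat_mult m (y :: 'a::{finite,ab_group_add}) \<in> K"
    "\<And>i. 0 < i \<Longrightarrow> i < m \<Longrightarrow> nat_mult i y \<notin> K"
proof -
  obtain N where "N > 0" "nat_mult N y = 0"
    using ex_nat_mult_eq_0 by blast
  then have "\<exists>i. 0 < i \<and> nat_mult i y \<in> K"
    using assms by (auto simp: partial_character_def)
  from LeastI_ex[OF this] not_less_Least[of _ "\<lambda>i. 0 < i \<and> nat_mult i y \<in> K"] that
  show thesis by blast
qed

text \<open>Adjoin one element at a time, by induction on the size of the complement of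
  \<open>K\<close>. The root \<open>c\<close> needed at each step exists because the complex field
  is algebraically closed.\<close>

lemma partial_character_extend:
  fixes K :: "'a::{finite,ab_group_add} set"
  assumes "partial_character K \<eta>"
  shows "\<exists>\<psi>. partial_character UNIV \<psi> \<and> (\<forall>k\<in>K. \<psi> k = \<eta> k)"
  using assms
proof (induction "card (- K)" arbitrary: K \<eta> rule: less_induct)
  case less
  show ?case
  proof (cases "K = UNIV")
    case True
    then show ?thesis using less.prems by blast
  next
    case False
    then obtain y where y: "y \<notin> K" by blast
    obtain m where m: "m > 0" "nat_mult m y \<in> K" "\<And>i. 0 < i \<Longrightarrow> i < m \<Longrightarrow> nat_mult i y \<notin> K"
      using ex_least_multiple[OF less.prems] by blast
    obtain c where "c ^ m = \<eta> (nat_mult m y)"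
      using exists_complex_root[of m] m(1) by (metis not_gr_zero)
    from partial_character_extend_step[OF less.prems m this]
    obtain L \<psi> where L: "partial_character L \<psi>" "K \<subseteq> L" "y \<in> L" "\<And>k. k \<in> K \<Longrightarrow> \<psi> k = \<eta> k"
      by blast
    have "card (- L) < card (- K)"
      using L(2,3) y by (intro psubset_card_mono) auto
    from less.hyps[OF this L(1)] L(2,4) show ?thesis by (metis subsetD)
  qed
qed

text \<open>Every element has finite order, so a multiplicative function with value 1 at 0 takes
  roots of unity as values and the bound to the unit circle is automatic.\<close>

lemma letter_character_iff_partial:
  "letter_character (\<eta> :: 'a::{finite,ab_group_add} \<Rightarrow> complex) \<longleftrightarrow> partial_character UNIV \<eta>"
proof
  assume pc: "partial_character UNIV \<eta>"
  have "cmod (\<eta> a) = 1" for a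
  proof -
    obtain N where N: "N > 0" "nat_mult N a = 0"
      using ex_nat_mult_eq_0 by blast
    then have "\<eta> a ^ N = 1"
      using partial_character_nat_mult[OF pc, of a N] pc by (simp add: partial_character_def)
    then have "cmod (\<eta> a) ^ N = 1" by (metis norm_one norm_power)
    then show ?thesis using N(1) power_eq_imp_eq_base[of "cmod (\<eta> a)" N 1] by simp
  qed
  then show "letter_character \<eta>"
    using pc by (auto simp: letter_character_def partial_character_def)
next
  assume "letter_character \<eta>"
  then show "partial_character UNIV \<eta>"
    by (simp add: partial_character_def letter_character_def letter_character_0)
qed

text \<open>Start from the trivial subgroup. The order \<open>m\<close> of \<open>x\<close> exceeds
  1, so some \<open>m\<close>-th root of unity differs from 1; it is taken as the value at
  \<open>x\<close>, and the result extends to the whole group.\<close>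

lemma letter_characters_separate:
  assumes "(x :: 'a::{finite,ab_group_add}) \<noteq> 0"
  obtains \<eta> where "letter_character \<eta>" "\<eta> x \<noteq> 1"
proof -
  have pc: "partial_character {0} (\<lambda>_. 1)"
    by (simp add: partial_character_def)
  obtain m where m: "m > 0" "nat_mult m x \<in> {0}" "\<And>i. 0 < i \<Longrightarrow> i < m \<Longrightarrow> nat_mult i x \<notin> {0}"
    using ex_least_multiple[OF pc] by blast
  have "m \<noteq> 1" using m(2) assms by auto
  have "card {c::complex. c ^ m = 1} = m"
    using m(1) by (rule card_roots_unity_eq)
  then have "\<not> {c::complex. c ^ m = 1} \<subseteq> {1}"
    using \<open>m \<noteq> 1\<close> m(1) card_mono[of "{1}" "{c::complex. c ^ m = 1}"] by auto
  then obtain c :: complex where c: "c ^ m = 1" "c \<noteq> 1" by blast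
  from partial_character_extend_step[OF pc m c(1)]
  obtain L \<psi> where L: "partial_character L \<psi>" "x \<in> L" "\<psi> x = c"
    by blast
  from partial_character_extend[OF L(1)] obtain \<eta> where "partial_character UNIV \<eta>" "\<eta> x = c"
    using L by metis
  then show thesis
    using that c by (simp add: letter_character_iff_partial)
qed

section \<open>Orthogonality relations\<close>

lemma letter_character_norm: "letter_character \<eta> \<Longrightarrow> cmod (\<eta> a) = 1"
  unfolding letter_character_def by fastforce

lemma letter_character_one: "letter_character (\<lambda>_. 1)"
  by (auto simp: letter_character_def)

lemma letter_character_add: "letter_character \<eta> \<Longrightarrow> \<eta> (a + b) = \<eta> a * \<eta> b"
  unfolding letter_character_def by blast

text \<open>Translating the summation variable by \<open>b\<close> with
  \<open>\<eta> b \<noteq> 1\<close> multiplies the sum by \<open>\<eta> b\<close>.\<close>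

lemma sum_letter_character:
  assumes \<eta>: "letter_character (\<eta> :: 'a::{finite,ab_group_add} \<Rightarrow> complex)" and "\<eta> \<noteq> (\<lambda>_. 1)"
  shows "(\<Sum>a\<in>UNIV. \<eta> a) = 0"
proof -
  obtain b where b: "\<eta> b \<noteq> 1" using assms(2) by blast
  have "(\<Sum>a\<in>UNIV. \<eta> a) = (\<Sum>a\<in>UNIV. \<eta> (b + a))"
    by (rule sum.reindex_bij_witness[of _ "\<lambda>a. b + a" "\<lambda>a. a - b"]) auto
  also have "\<dots> = \<eta> b * (\<Sum>a\<in>UNIV. \<eta> a)"
    by (simp add: letter_character_add[OF \<eta>] sum_distrib_left)
  finally show ?thesis using b by simp
qed

lemma finite_letter_characters:
  "finite {\<eta> :: 'a::{finite,ab_group_add} \<Rightarrow> complex. letter_character \<eta>}"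
proof -
  \<comment> \<open>\<open>N\<close> is a common exponent of the group, so all characters take
    values in the finite set of \<open>N\<close>-th roots of unity.\<close>
  define N where "N = (\<Prod>a\<in>(UNIV :: 'a set). SOME N. N > 0 \<and> nat_mult N a = 0)"
  have some: "(SOME N. N > 0 \<and> nat_mult N a = 0) > 0 \<and> nat_mult (SOME N. N > 0 \<and> nat_mult N a = 0) a = 0"
    for a :: 'a
    using someI_ex[OF ex_nat_mult_eq_0[of a]] by simp
  have N: "N > 0" unfolding N_def by (rule prod_pos) (use some in blast)
  have "\<eta> a ^ N = 1" if "letter_character \<eta>" for \<eta> and a :: 'a
  proof -
    have pc: "partial_character UNIV \<eta>" using that by (simp add: letter_character_iff_partial)
    have "(SOME N. N > 0 \<and> nat_mult N a = 0) dvd N"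
      unfolding N_def by (rule dvd_prodI) auto
    then obtain q where q: "N = (SOME N. N > 0 \<and> nat_mult N a = 0) * q" by blast
    have "\<eta> a ^ (SOME N. N > 0 \<and> nat_mult N a = 0) = 1"
      using partial_character_nat_mult[OF pc, of a "SOME N. N > 0 \<and> nat_mult N a = 0"] some[of a] pc
      by (simp add: partial_character_def)
    then show ?thesis by (subst q) (simp only: power_mult power_one)
  qed
  then have "{\<eta> :: 'a \<Rightarrow> complex. letter_character \<eta>} \<subseteq> UNIV \<rightarrow>\<^sub>E {c. c ^ N = 1}"
    by (auto simp: PiE_def)
  then show ?thesis
    by (rule finite_subset) (use finite_roots_unity[of N] N in \<open>auto intro: finite_PiE\<close>)
qed

text \<open>For \<open>x \<noteq> 0\<close>, multiplication by a character that separates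
  \<open>x\<close> from 0 permutes all characters and scales the sum by a factor other than
  1.\<close>

lemma sum_over_letter_characters:
  fixes x :: "'a::{finite,ab_group_add}"
  shows "(\<Sum>\<eta> | letter_character \<eta>. \<eta> x) = (if x = 0 then of_nat CARD('a) else 0)"
proof -
  let ?D = "{\<eta> :: 'a \<Rightarrow> complex. letter_character \<eta>}"
  have nz: "(\<Sum>\<eta>\<in>?D. \<eta> x) = 0" if x: "x \<noteq> 0" for x
  proof -
    obtain \<psi> where \<psi>: "letter_character \<psi>" "\<psi> x \<noteq> 1"
      using letter_characters_separate[OF x] by blast
    have closed: "letter_character (\<lambda>a. \<psi> a * \<eta> a)" "letter_character (\<lambda>a. \<eta> a / \<psi> a)"
      if "letter_character \<eta>" for \<eta>
      using \<psi>(1) that letter_character_norm[OF that] letter_character_norm[OF \<psi>(1)]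
      by (auto simp: letter_character_def norm_mult norm_divide)
    have ne: "\<psi> a \<noteq> 0" for a using letter_character_norm[OF \<psi>(1), of a] by auto
    have "(\<Sum>\<eta>\<in>?D. \<eta> x) = (\<Sum>\<eta>\<in>?D. \<psi> x * \<eta> x)"
      by (rule sum.reindex_bij_witness[of _ "\<lambda>\<eta> a. \<psi> a * \<eta> a" "\<lambda>\<eta> a. \<eta> a / \<psi> a"])
        (use closed in \<open>auto simp: ne\<close>)
    then show ?thesis using \<psi>(2) by (simp flip: sum_distrib_left)
  qed
  \<comment> \<open>Double counting gives the number of characters: in the sum of
    \<open>\<eta> a\<close> over all pairs, summing over \<open>\<eta>\<close> first leaves only
    \<open>a = 0\<close>, summing over \<open>a\<close> first leaves only the trivial
    character.\<close>
  have "of_nat (card ?D) = (\<Sum>\<eta>\<in>?D. \<eta> 0)"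
    by (simp add: letter_character_0)
  also have "\<dots> = (\<Sum>a\<in>UNIV. \<Sum>\<eta>\<in>?D. \<eta> a)"
    using nz by (subst sum.remove[of UNIV 0]) auto
  also have "\<dots> = (\<Sum>\<eta>\<in>?D. \<Sum>a\<in>UNIV. \<eta> a)"
    by (rule sum.swap)
  also have "\<dots> = (\<Sum>\<eta>\<in>?D. if \<eta> = (\<lambda>_. 1) then of_nat CARD('a) else 0)"
    by (intro sum.cong refl) (simp add: sum_letter_character)
  also have "\<dots> = of_nat CARD('a)"
    using finite_letter_characters letter_character_one by (subst sum.delta) auto
  finally show ?thesis using nz by (simp add: letter_character_0)
qed

subsection \<open>Spreading of characters under the automaton\<close>

text \<open>
  The fundamental solution, up to sign, of the recurrence \<open>a\<^sub>t\<^sub>+\<^sub>1 = - (\<sigma> + \<sigma>\<inverse>) a\<^sub>t - a\<^sub>t\<^sub>-\<^sub>1\<close> on one coset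
  of \<open>n\<int>\<close>: by time \<open>t\<close> a lone letter \<open>(a, b)\<close> has spread over all sites at distance at most \<open>t\<close>
  (in units of \<open>n\<close>), with \<open>a\<close> and \<open>b\<close> on alternating sites.
\<close>

definition wave :: "nat \<Rightarrow> int \<Rightarrow> 'g \<Rightarrow> 'g \<Rightarrow> 'g::ab_group_add" where
  "wave t s a b =
     (if even (s + int t) then if \<bar>s\<bar> \<le> int t then a else 0
      else if \<bar>s\<bar> < int t then b else 0)"

text \<open>All four values have space-time parity equal to that of \<open>s + t\<close>, so they
  involve the same letter, and the identity only compares which of the intervals contain
  \<open>s\<close>.\<close>

lemma wave_rec:
  "wave (Suc (Suc t)) s a b = wave (Suc t) (s - 1) a b + wave (Suc t) (s + 1) a b - wave t s a b"
proof -
  have parity: "even (s + int (Suc (Suc t))) = even (s + int t)"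
    "even (s - 1 + int (Suc t)) = even (s + int t)" "even (s + 1 + int (Suc t)) = even (s + int t)"
    by simp_all
  show ?thesis
  proof (cases "even (s + int t)")
    case True
    \<comment> \<open>Parity leaves only the interior, the two new end sites and the
      exterior.\<close>
    have "s \<noteq> int t + 1" "s \<noteq> - int t - 1"
      using True by auto
    then have "\<bar>s\<bar> \<le> int t \<or> s = int t + 2 \<or> s = - int t - 2 \<or> \<bar>s\<bar> > int t + 2"
      by linarith
    then show ?thesis
      unfolding wave_def parity if_P[OF True] by (elim disjE) auto
  next
    case False
    have "s \<noteq> int t" "s \<noteq> - int t"
      using False by auto
    then have "\<bar>s\<bar> < int t \<or> s = int t + 1 \<or> s = - int t - 1 \<or> \<bar>s\<bar> > int t + 1"
      by linarith
    then show ?thesis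
      unfolding wave_def parity if_not_P[OF False] by (elim disjE) auto
  qed
qed

text \<open>The sign \<open>(-1)^t\<close>, which turns the recurrence of the automaton into that of
  \<open>wave\<close>.\<close>

definition alternate :: "nat \<Rightarrow> 'g \<Rightarrow> 'g::ab_group_add" where
  "alternate t x = (if even t then x else - x)"

text \<open>The local rule links only sites that differ by multiples of \<open>n\<close>, so a lone
  letter never leaves its coset.\<close>

lemma I_CA_iterate_single_off:
  assumes "\<not> int n dvd z - k"
  shows "(I_CA n ^^ t) (\<lambda>j. if j = k then p else 0) z = 0"
  using assms
proof (induction t arbitrary: z)
  case 0
  then show ?case by (cases "z = k") auto
next
  case (Suc t)
  have "int n dvd z - k" if "int n dvd z - int n - k \<or> int n dvd z + int n - k"
    using that dvd_add[of "int n" "z - int n - k" "int n"] dvd_diff[of "int n" "z + int n - k" "int n"]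
    by (auto simp: diff_diff_eq2 add_diff_eq diff_add_eq)
  then have "(I_CA n ^^ t) (\<lambda>j. if j = k then p else 0) y = 0" if "y \<in> {z, z - int n, z + int n}" for y
    using that Suc.IH Suc.prems by blast
  then show ?case
    by (simp, subst I_CA_def) (simp add: zero_prod_def)
qed

text \<open>The second component lags one step behind the first, so the formula starts at time 1; at
  time 0 it would refer to \<open>wave\<close> at time -1.\<close>

lemma I_CA_iterate_single_on:
  assumes "n \<ge> 1"
  shows "(I_CA n ^^ Suc t) (\<lambda>j. if j = k then (a, b) else 0) (k + int n * s)
    = (alternate (Suc t) (wave (Suc t) s a b), alternate t (wave t s a b))"
proof (induction t arbitrary: s)
  case 0
  have "int n * s = int n \<longleftrightarrow> s = 1" "int n * s = - int n \<longleftrightarrow> s = -1"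
    using assms mult_cancel_left[of "int n" s 1] mult_cancel_left[of "int n" s "-1"] by auto
  moreover have "int n * s + int n = 0 \<longleftrightarrow> int n * s = - int n" by linarith
  ultimately show ?case
    using assms by (auto simp: I_CA_def alternate_def wave_def zero_prod_def)
next
  case (Suc t)
  have "k + int n * s - int n = k + int n * (s - 1)" "k + int n * s + int n = k + int n * (s + 1)"
    by (simp_all add: algebra_simps)
  then have "(I_CA n ^^ Suc (Suc t)) (\<lambda>j. if j = k then (a, b) else 0) (k + int n * s)
    = (- (alternate (Suc t) (wave (Suc t) (s - 1) a b) + alternate (Suc t) (wave (Suc t) (s + 1) a b)
          + alternate t (wave t s a b)), alternate (Suc t) (wave (Suc t) s a b))"
    using Suc.IH[of "s - 1"] Suc.IH[of "s + 1"] Suc.IH[of s]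
    by (subst funpow.simps(2), subst o_apply, subst I_CA_def) (simp only: fst_conv snd_conv)
  also have "\<dots> = (alternate (Suc (Suc t)) (wave (Suc (Suc t)) s a b), alternate (Suc t) (wave (Suc t) s a b))"
    by (simp add: wave_rec alternate_def)
  finally show ?case .
qed

text \<open>Strictly inside the cone the letter at time \<open>t + 1\<close> consists of
  \<open>a\<close> and \<open>b\<close> up to order and signs, which is a bijective function of the
  initial letter. The witnesses undo the swap and the signs.\<close>

lemma I_CA_iterate_single_surj:
  assumes "n \<ge> 1" "\<bar>s\<bar> < int t"
  obtains p where "(I_CA n ^^ Suc t) (\<lambda>j. if j = k then p else 0) (k + int n * s) = q"
proof -
  obtain c d where q: "q = (c, d)" by (cases q)
  show thesis
  proof (cases "even (s + int t)")
    case True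
    show thesis
      by (rule that[of "(alternate t d, alternate (Suc t) c)"], subst I_CA_iterate_single_on)
        (use True assms q in \<open>auto simp: wave_def alternate_def\<close>)
  next
    case False
    show thesis
      by (rule that[of "(alternate (Suc t) c, alternate t d)"], subst I_CA_iterate_single_on)
        (use False assms q in \<open>auto simp: wave_def alternate_def\<close>)
  qed
qed

section \<open>Pulling characters back along the automaton\<close>

lemma I_CA_add:
  "I_CA n (\<lambda>z. x z + y z) = (\<lambda>z. I_CA n x z + I_CA n y z)"
  by (auto simp: I_CA_def fun_eq_iff)

lemma I_CA_iterate_add:
  "(I_CA n ^^ t) (\<lambda>z. x z + y z) = (\<lambda>z. (I_CA n ^^ t) x z + (I_CA n ^^ t) y z)"
  by (induction t) (auto simp: I_CA_add)

lemma continuous_map_I_CA_iterate: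
  "continuous_map config_topology config_topology (I_CA n ^^ t)"
proof (induction t)
  case 0
  show ?case using continuous_map_id by (simp add: id_def)
next
  case (Suc t)
  then show ?case using continuous_map_compose[OF _ continuous_map_I_CA] by (simp only: funpow.simps)
qed

lemma config_character_I_CA_iterate:
  assumes "config_character \<xi>"
  shows "config_character (\<xi> \<circ> (I_CA n ^^ t))"
  unfolding config_character_def
proof (intro conjI allI)
  show "continuous_map config_topology euclidean (\<xi> \<circ> (I_CA n ^^ t))"
    using assms continuous_map_compose[OF continuous_map_I_CA_iterate]
    unfolding config_character_def by blast
qed (use assms in \<open>auto simp: config_character_def I_CA_iterate_add\<close>)

text \<open>Makes the rank accessible without the factorization: a site counts exactly when some
  configuration supported there is not sent to 1.\<close>

lemma character_support_eq:
  assumes "config_character \<xi>"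
  shows "character_support (THE \<phi>. character_factors \<xi> \<phi>)
    = {k. \<exists>a. \<xi> (\<lambda>j. if j = k then a else 0) \<noteq> 1}"
    and "finite (character_support (THE \<phi>. character_factors \<xi> \<phi>))"
proof -
  define \<phi> where "\<phi> = (THE \<phi>. character_factors \<xi> \<phi>)"
  have *: "character_factors \<xi> \<phi>"
    unfolding \<phi>_def by (rule theI'[OF config_character_ex1_factors[OF assms]])
  then have "finite (character_support \<phi>)"
    by (simp add: character_factors_def)
  moreover have "character_support \<phi> = {k. \<exists>a. \<xi> (\<lambda>j. if j = k then a else 0) \<noteq> 1}"
    unfolding character_support_def fun_eq_iff character_factors_single[OF *] by simp
  ultimately show "character_support (THE \<phi>. character_factors \<xi> \<phi>)
      = {k. \<exists>a. \<xi> (\<lambda>j. if j = k then a else 0) \<noteq> 1}"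
    and "finite (character_support (THE \<phi>. character_factors \<xi> \<phi>))"
    unfolding \<phi>_def by auto
qed

lemma config_character_prod:
  fixes \<phi> :: "int \<Rightarrow> 'a::ab_group_add \<Rightarrow> complex"
  assumes "finite S" "\<And>k. k \<in> S \<Longrightarrow> letter_character (\<phi> k)"
  shows "config_character (\<lambda>x. \<Prod>k\<in>S. \<phi> k (x k))"
  unfolding config_character_def
proof (intro conjI allI)
  have "continuous_map config_topology euclidean (\<lambda>x. \<phi> k (x k))" for k
  proof -
    have "continuous_map config_topology (discrete_topology UNIV) (\<lambda>x :: int \<Rightarrow> 'a. x k)"
      unfolding config_topology_def by (rule continuous_map_product_projection) simp
    moreover have "continuous_map (discrete_topology UNIV) euclidean (\<phi> k)"
      by simp
    ultimately show ?thesis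
      by (rule continuous_map_compose[unfolded o_def])
  qed
  with assms(1) show "continuous_map config_topology euclidean (\<lambda>x. \<Prod>k\<in>S. \<phi> k (x k))"
  proof (induction S rule: finite_induct)
    case (insert k S)
    then have "continuous_map config_topology euclidean (\<lambda>x. (\<phi> k (x k), \<Prod>j\<in>S. \<phi> j (x j)))"
      unfolding prod_topology_euclidean[symmetric] by (intro continuous_map_pairedI) auto
    moreover have "continuous_map euclidean euclidean (\<lambda>(u, v). u * v :: complex)"
      by (auto simp: case_prod_unfold intro!: continuous_intros)
    ultimately have "continuous_map config_topology euclidean
        ((\<lambda>(u, v). u * v) \<circ> (\<lambda>x. (\<phi> k (x k), \<Prod>j\<in>S. \<phi> j (x j))))"
      by (rule continuous_map_compose)
    then show ?case using insert by (simp add: o_def)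
  qed simp
  show "range (\<lambda>x. \<Prod>k\<in>S. \<phi> k (x k)) \<subseteq> sphere 0 1"
  proof -
    have "cmod (\<Prod>k\<in>S. \<phi> k (x k)) = 1" for x
      unfolding prod_norm[symmetric] by (intro prod.neutral) (simp add: letter_character_norm[OF assms(2)])
    then show ?thesis by auto
  qed
  show "(\<Prod>k\<in>S. \<phi> k (x k + y k)) = (\<Prod>k\<in>S. \<phi> k (x k)) * (\<Prod>k\<in>S. \<phi> k (y k))" for x y
    unfolding prod.distrib[symmetric] using assms(2)
    by (intro prod.cong refl) (rule letter_character_add)
qed

text \<open>From each of the \<open>t\<close> sites \<open>i - n s\<close> with
  \<open>s < t\<close>, a suitable lone letter produces at \<open>i\<close> a letter detected by
  \<open>\<phi> i\<close> and reaches no other site of the window. All these sites therefore lie in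
  the support of the pullback.\<close>

lemma rank_window_character_I_CA:
  fixes \<phi> :: "int \<Rightarrow> 'g \<times> 'g::ab_group_add \<Rightarrow> complex"
  assumes n: "n \<ge> 1" and \<phi>: "\<And>j. letter_character (\<phi> j)"
    and i: "i \<in> {k..<k + int n}" "\<phi> i \<noteq> (\<lambda>_. 1)"
  shows "t \<le> character_rank ((\<lambda>x. \<Prod>j\<in>{k..<k + int n}. \<phi> j (x j)) \<circ> (I_CA n ^^ Suc t))"
    (is "t \<le> character_rank ?\<xi>")
proof -
  let ?S = "character_support (THE \<phi>. character_factors ?\<xi> \<phi>)"
  have char: "config_character ?\<xi>"
    using \<phi> by (intro config_character_I_CA_iterate config_character_prod) auto
  obtain q where q: "\<phi> i q \<noteq> 1" using i(2) by blast
  have "i - int n * int s \<in> ?S" if "s < t" for s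
  proof -
    define l where "l = i - int n * int s"
    have "\<bar>int s\<bar> < int t" using \<open>s < t\<close> by simp
    then obtain p where p: "(I_CA n ^^ Suc t) (\<lambda>j. if j = l then p else 0) (l + int n * int s) = q"
      by (rule I_CA_iterate_single_surj[OF n])
    define y where "y = (I_CA n ^^ Suc t) (\<lambda>j. if j = l then p else 0)"
    have "y j = 0" if "j \<in> {k..<k + int n}" "j \<noteq> i" for j
      unfolding y_def
    proof (rule I_CA_iterate_single_off)
      \<comment> \<open>The window length enters here: distinct sites of a window of length
        \<open>n\<close> are incongruent modulo \<open>n\<close>.\<close>
      have "\<not> int n dvd j - i"
        using that i(1) zdvd_imp_le[of "int n" "\<bar>j - i\<bar>"] by auto
      moreover have "j - l = (j - i) + int n * int s" by (simp add: l_def)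
      ultimately show "\<not> int n dvd j - l"
        by (simp only: dvd_add_left_iff[OF dvd_triv_left] not_False_eq_True)
    qed
    then have "(\<Prod>j\<in>{k..<k + int n}. \<phi> j (y j)) = \<phi> i (y i)"
      using i(1) by (subst prod.remove[of _ i]) (auto simp: letter_character_0[OF \<phi>] intro!: prod.neutral)
    moreover have "y i = q" using p by (simp add: y_def l_def)
    ultimately have "?\<xi> (\<lambda>j. if j = l then p else 0) \<noteq> 1"
      using q by (simp add: y_def del: funpow.simps)
    then show ?thesis
      unfolding character_support_eq(1)[OF char] l_def by blast
  qed
  then have "(\<lambda>s. i - int n * int s) ` {..<t} \<subseteq> ?S" by auto
  from card_mono[OF character_support_eq(2)[OF char] this]
  show ?thesis
    using n by (simp add: character_rank_def card_image inj_on_def)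
qed

subsection \<open>Randomization of short cylinders\<close>

lemma config_borel_measurable_continuous:
  assumes "continuous_map config_topology euclidean (f :: _ \<Rightarrow> complex)"
  shows "f \<in> borel_measurable config_borel"
proof (rule borel_measurableI)
  fix U :: "complex set" assume "open U"
  then have "openin config_topology {x \<in> topspace config_topology. f x \<in> U}"
    using openin_continuous_map_preimage[OF assms] by simp
  then show "f -` U \<inter> space config_borel \<in> sets config_borel"
    by (auto simp: sets_config_borel vimage_def)
qed

lemma config_character_measurable: "config_character \<xi> \<Longrightarrow> \<xi> \<in> borel_measurable config_borel"
  unfolding config_character_def using config_borel_measurable_continuous by blast

lemma config_prob_measurable_iff:
  "config_prob \<mu> \<Longrightarrow> f \<in> measurable \<mu> N \<longleftrightarrow> f \<in> measurable config_borel N"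
  by (rule arg_cong[of _ _ "\<lambda>S. f \<in> S"], rule measurable_cong_sets) (auto simp: config_prob_def)

lemma config_prob_distr:
  assumes "config_prob \<mu>"
  shows "config_prob (distr \<mu> config_borel (I_CA n ^^ t))"
  using assms measurable_config_borel[OF continuous_map_I_CA_iterate]
  unfolding config_prob_def
  by (auto intro!: prob_space.prob_space_distr simp: config_prob_measurable_iff[OF assms])

lemma integral_distr_I_CA:
  fixes f :: "_ \<Rightarrow> complex"
  assumes "config_prob \<mu>" "f \<in> borel_measurable config_borel"
  shows "(\<integral>x. f x \<partial>distr \<mu> config_borel (I_CA n ^^ t)) = (\<integral>x. f ((I_CA n ^^ t) x) \<partial>\<mu>)"
  using measurable_config_borel[OF continuous_map_I_CA_iterate] assms
  by (intro integral_distr) (auto simp: config_prob_measurable_iff)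

lemma config_character_integrable:
  assumes "config_prob \<mu>" "config_character \<xi>"
  shows "integrable \<mu> \<xi>"
proof -
  interpret prob_space \<mu> using assms by (simp add: config_prob_def)
  show ?thesis
    using assms config_character_norm[OF assms(2)]
    by (intro integrable_const_bound[of _ 1]) (auto simp: config_prob_measurable_iff config_character_measurable)
qed

lemma integral_indicator_cylinder:
  assumes "config_prob \<nu>"
  shows "integrable \<nu> (\<lambda>x. indicator (cylinder k u) x :: complex)"
    and "(\<integral>x. indicator (cylinder k u) x \<partial>\<nu>) = complex_of_real (measure \<nu> (cylinder k u))"
proof -
  interpret prob_space \<nu> using assms by (simp add: config_prob_def)
  have sets: "cylinder k u \<in> sets \<nu>"
    using assms cylinder_in_sets by (auto simp: config_prob_def)
  have "integrable \<nu> (indicator (cylinder k u) :: _ \<Rightarrow> real)"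
    by (rule integrable_real_indicator[OF sets]) (simp add: emeasure_eq_measure)
  then have "integrable \<nu> (\<lambda>x. complex_of_real (indicator (cylinder k u) x))"
    by (rule integrable_of_real)
  then show "integrable \<nu> (\<lambda>x. indicator (cylinder k u) x :: complex)"
    by (simp only: of_real_indicator)
  have "(\<integral>x. complex_of_real (indicator (cylinder k u) x) \<partial>\<nu>) = complex_of_real (\<integral>x. indicator (cylinder k u) x \<partial>\<nu>)"
    by (rule integral_complex_of_real)
  then show "(\<integral>x. indicator (cylinder k u) x \<partial>\<nu>) = complex_of_real (measure \<nu> (cylinder k u))"
    using sets by (simp add: of_real_indicator)
qed

lemma harmonically_mixing_rank_tendsto:
  assumes "harmonically_mixing \<mu>" "\<And>t. config_character (\<xi> t)"
    and "filterlim (\<lambda>t. character_rank (\<xi> t)) at_top sequentially"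
  shows "(\<lambda>t. \<integral>x. \<xi> t x \<partial>\<mu>) \<longlonglongrightarrow> 0"
proof (rule tendstoI)
  fix \<epsilon> :: real assume "\<epsilon> > 0"
  then obtain R :: real where R: "\<And>\<xi>. config_character \<xi> \<Longrightarrow> real (character_rank \<xi>) > R \<Longrightarrow>
        cmod (\<integral>x. \<xi> x \<partial>\<mu>) < \<epsilon>"
    using assms(1) unfolding harmonically_mixing_def by blast
  have "\<forall>\<^sub>F t in sequentially. Suc (nat \<lceil>R\<rceil>) \<le> character_rank (\<xi> t)"
    using assms(3) by (simp add: filterlim_at_top del: Suc_le_eq)
  then show "\<forall>\<^sub>F t in sequentially. dist (\<integral>x. \<xi> t x \<partial>\<mu>) 0 < \<epsilon>"
  proof eventually_elim
    case (elim t)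
    then have "real (character_rank (\<xi> t)) > R" by linarith
    from R[OF assms(2) this] show ?case by simp
  qed
qed

text \<open>Fourier inversion: at each site orthogonality detects
  \<open>x j = u ! nat (j - k)\<close>, and expanding the product over the window gives a sum over
  families of characters. Extensional families count each choice on the window once.\<close>

lemma indicator_cylinder_characters:
  fixes u :: "'a::{finite,ab_group_add} list" and k :: int
  defines "J \<equiv> {k..<k + int (length u)}"
  shows "indicator (cylinder k u) x
    = (\<Sum>\<phi>\<in>J \<rightarrow>\<^sub>E {\<eta>. letter_character \<eta>}.
        (\<Prod>j\<in>J. \<phi> j (- u ! nat (j - k))) * (\<Prod>j\<in>J. \<phi> j (x j))) / of_nat CARD('a) ^ length u"
proof -
  define y where "y j = x j - u ! nat (j - k)" for j
  have "(\<Sum>\<phi>\<in>J \<rightarrow>\<^sub>E {\<eta>. letter_character \<eta>}. (\<Prod>j\<in>J. \<phi> j (- u ! nat (j - k))) * (\<Prod>j\<in>J. \<phi> j (x j)))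
    = (\<Sum>\<phi>\<in>J \<rightarrow>\<^sub>E {\<eta>. letter_character \<eta>}. \<Prod>j\<in>J. \<phi> j (y j))"
  proof (intro sum.cong refl)
    fix \<phi> assume "\<phi> \<in> J \<rightarrow>\<^sub>E {\<eta> :: 'a \<Rightarrow> complex. letter_character \<eta>}"
    then have "letter_character (\<phi> j)" if "j \<in> J" for j using that by auto
    then show "(\<Prod>j\<in>J. \<phi> j (- u ! nat (j - k))) * (\<Prod>j\<in>J. \<phi> j (x j)) = (\<Prod>j\<in>J. \<phi> j (y j))"
      unfolding prod.distrib[symmetric]
      by (intro prod.cong refl) (simp add: y_def letter_character_add[symmetric])
  qed
  also have "\<dots> = (\<Prod>j\<in>J. \<Sum>\<eta> | letter_character \<eta>. \<eta> (y j))"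
    by (rule prod_sum_PiE[symmetric]) (auto simp: J_def finite_letter_characters)
  also have "\<dots> = (\<Prod>j\<in>J. if y j = 0 then of_nat CARD('a) else 0)"
    by (simp add: sum_over_letter_characters)
  also have "\<dots> = (if \<forall>j\<in>J. y j = 0 then of_nat CARD('a) ^ length u else 0)"
  proof (cases "\<forall>j\<in>J. y j = 0")
    case False
    then show ?thesis by (auto simp: J_def intro!: prod_zero)
  qed (simp add: J_def)
  also have "(\<forall>j\<in>J. y j = 0) \<longleftrightarrow> x \<in> cylinder k u"
  proof
    assume *: "\<forall>j\<in>J. y j = 0"
    have "x (k + int i) = u ! i" if "i < length u" for i
      using bspec[OF *, of "k + int i"] that by (simp add: J_def y_def)
    then show "x \<in> cylinder k u" by (simp add: cylinder_def)
  next
    assume *: "x \<in> cylinder k u"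
    show "\<forall>j\<in>J. y j = 0"
    proof
      fix j assume "j \<in> J"
      then have "nat (j - k) < length u" "k + int (nat (j - k)) = j" by (auto simp: J_def)
      then show "y j = 0" using * by (force simp: cylinder_def y_def)
    qed
  qed
  finally show ?thesis by (simp add: indicator_def)
qed

text \<open>The cylinder probability is a fixed finite combination of integrals of pulled-back
  window characters. All but the trivial one tend to 0, since their ranks tend to infinity.\<close>

lemma randomizes_cylinders_I_CA:
  assumes n: "n \<ge> 1"
  shows "randomizes_cylinders (I_CA n :: (int \<Rightarrow> 'g \<times> 'g) \<Rightarrow> (int \<Rightarrow> 'g \<times> 'g::{finite,ab_group_add})) n"
  unfolding randomizes_cylinders_def
proof (intro allI impI)
  fix \<mu> :: "(int \<Rightarrow> 'g \<times> 'g) measure" and u :: "('g \<times> 'g) list" and k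
  assume \<mu>: "config_prob \<mu>" and mix: "harmonically_mixing \<mu>" and u: "length u = n"
  define J where "J = {k..<k + int n}"
  define D where "D = J \<rightarrow>\<^sub>E {\<eta> :: 'g \<times> 'g \<Rightarrow> complex. letter_character \<eta>}"
  define c where "c \<phi> = (\<Prod>j\<in>J. \<phi> j (- u ! nat (j - k)))" for \<phi> :: "int \<Rightarrow> 'g \<times> 'g \<Rightarrow> complex"
  define \<xi> where "\<xi> \<phi> x = (\<Prod>j\<in>J. \<phi> j (x j))" for \<phi> :: "int \<Rightarrow> 'g \<times> 'g \<Rightarrow> complex" and x
  \<comment> \<open>The trivial family, restricted to \<open>J\<close> so that it belongs to the
    extensional index set \<open>D\<close>.\<close>
  define \<tau> :: "int \<Rightarrow> 'g \<times> 'g \<Rightarrow> complex" where "\<tau> = (\<lambda>j\<in>J. \<lambda>_. 1)"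
  have finJ: "finite J" by (simp add: J_def)
  have finD: "finite D"
    unfolding D_def using finJ finite_letter_characters by (rule finite_PiE)
  have \<tau>: "\<tau> \<in> D" by (auto simp: \<tau>_def D_def letter_character_one)
  have char: "config_character (\<xi> \<phi>)" if "\<phi> \<in> D" for \<phi>
    unfolding \<xi>_def using that finJ by (intro config_character_prod) (auto simp: D_def)
  interpret prob_space \<mu> using \<mu> by (simp add: config_prob_def)
  have lim: "(\<lambda>t. \<integral>x. \<xi> \<phi> ((I_CA n ^^ t) x) \<partial>\<mu>) \<longlonglongrightarrow> (if \<phi> = \<tau> then 1 else 0)" if \<phi>: "\<phi> \<in> D" for \<phi>
  proof (cases "\<phi> = \<tau>")
    case True
    then show ?thesis by (simp add: \<xi>_def \<tau>_def prob_space)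
  next
    case False
    obtain i where i: "i \<in> J" "\<phi> i \<noteq> (\<lambda>_. 1)"
    proof (rule ccontr)
      assume "\<not> thesis"
      then have "\<phi> i = \<tau> i" for i
        using \<phi> that by (cases "i \<in> J") (auto simp: \<tau>_def D_def)
      then show False using False by auto
    qed
    \<comment> \<open>Outside \<open>J\<close> the family \<open>\<phi>\<close> is
      \<open>undefined\<close>; filling in trivial characters makes every factor a character without
      changing the product.\<close>
    define \<psi> where "\<psi> j = (if j \<in> J then \<phi> j else (\<lambda>_. 1))" for j
    have \<psi>: "letter_character (\<psi> j)" for j
      using \<phi> by (auto simp: \<psi>_def D_def letter_character_one)
    have \<xi>_eq: "\<xi> \<phi> = (\<lambda>x. \<Prod>j\<in>{k..<k + int n}. \<psi> j (x j))"
      by (auto simp: \<xi>_def \<psi>_def J_def fun_eq_iff intro!: prod.cong)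
    have "t \<le> character_rank (\<xi> \<phi> \<circ> (I_CA n ^^ Suc t))" for t
      unfolding \<xi>_eq by (rule rank_window_character_I_CA[OF n \<psi>, of i]) (use i in \<open>auto simp: J_def \<psi>_def\<close>)
    then have "filterlim (\<lambda>t. character_rank (\<xi> \<phi> \<circ> (I_CA n ^^ Suc t))) at_top sequentially"
      by (intro filterlim_at_top_mono[OF filterlim_ident]) (simp del: funpow.simps)
    then have "(\<lambda>t. \<integral>x. (\<xi> \<phi> \<circ> (I_CA n ^^ Suc t)) x \<partial>\<mu>) \<longlonglongrightarrow> 0"
      by (intro harmonically_mixing_rank_tendsto mix config_character_I_CA_iterate char \<phi>)
    then have "(\<lambda>t. \<integral>x. \<xi> \<phi> ((I_CA n ^^ t) x) \<partial>\<mu>) \<longlonglongrightarrow> 0"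
      unfolding o_apply by (rule LIMSEQ_imp_Suc)
    then show ?thesis using False by simp
  qed
  have meas: "complex_of_real (measure (distr \<mu> config_borel (I_CA n ^^ t)) (cylinder k u))
      = (\<Sum>\<phi>\<in>D. c \<phi> * (\<integral>x. \<xi> \<phi> ((I_CA n ^^ t) x) \<partial>\<mu>)) / of_nat CARD('g \<times> 'g) ^ n" for t
  proof -
    let ?\<nu> = "distr \<mu> config_borel (I_CA n ^^ t)"
    have \<nu>: "config_prob ?\<nu>" by (rule config_prob_distr[OF \<mu>])
    have "complex_of_real (measure ?\<nu> (cylinder k u)) = (\<integral>x. indicator (cylinder k u) x \<partial>?\<nu>)"
      by (rule integral_indicator_cylinder(2)[OF \<nu>, symmetric])
    also have "\<dots> = (\<integral>x. (\<Sum>\<phi>\<in>D. c \<phi> * \<xi> \<phi> x) / of_nat CARD('g \<times> 'g) ^ n \<partial>?\<nu>)"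
      unfolding indicator_cylinder_characters D_def c_def \<xi>_def J_def u ..
    also have "\<dots> = (\<Sum>\<phi>\<in>D. c \<phi> * (\<integral>x. \<xi> \<phi> x \<partial>?\<nu>)) / of_nat CARD('g \<times> 'g) ^ n"
      using config_character_integrable[OF \<nu> char] by (simp add: Bochner_Integration.integral_sum)
    also have "(\<Sum>\<phi>\<in>D. c \<phi> * (\<integral>x. \<xi> \<phi> x \<partial>?\<nu>)) = (\<Sum>\<phi>\<in>D. c \<phi> * (\<integral>x. \<xi> \<phi> ((I_CA n ^^ t) x) \<partial>\<mu>))"
      by (intro sum.cong refl) (simp only: integral_distr_I_CA[OF \<mu> config_character_measurable[OF char]])
    finally show ?thesis .
  qed
  have "(\<lambda>t. (\<Sum>\<phi>\<in>D. c \<phi> * (\<integral>x. \<xi> \<phi> ((I_CA n ^^ t) x) \<partial>\<mu>)) / of_nat CARD('g \<times> 'g) ^ n)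
      \<longlonglongrightarrow> (\<Sum>\<phi>\<in>D. c \<phi> * (if \<phi> = \<tau> then 1 else 0)) / of_nat CARD('g \<times> 'g) ^ n"
    by (intro tendsto_intros lim) auto
  also have "(\<Sum>\<phi>\<in>D. c \<phi> * (if \<phi> = \<tau> then 1 else 0)) = c \<tau>"
    using finD \<tau> by (simp add: if_distrib sum.delta cong: if_cong)
  also have "c \<tau> = 1" by (simp add: c_def \<tau>_def)
  finally have "(\<lambda>t. complex_of_real (measure (distr \<mu> config_borel (I_CA n ^^ t)) (cylinder k u)))
      \<longlonglongrightarrow> complex_of_real (1 / real CARD('g \<times> 'g) ^ n)"
    unfolding meas by simp
  then show "(\<lambda>t. measure (distr \<mu> config_borel (I_CA n ^^ t)) (cylinder k u))
      \<longlonglongrightarrow> 1 / real CARD('g \<times> 'g) ^ n"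
    unfolding tendsto_of_real_iff .
qed

subsection \<open>A mixing measure with a persistent soliton\<close>

text \<open>The uniform part annihilates nontrivial characters and the atom at 0 contributes 1/2.
  This mean is below 1, which yields mixing, and nonzero, which leaves a visible trace.\<close>

definition lazy_uniform_pmf :: "'a::{finite,zero} pmf" where
  "lazy_uniform_pmf = bind_pmf (bernoulli_pmf (1/2)) (\<lambda>b. if b then pmf_of_set UNIV else return_pmf 0)"

lemma pmf_lazy_uniform:
  "pmf (lazy_uniform_pmf :: 'a::{finite,zero} pmf) x = 1 / 2 * (1 / CARD('a)) + (if x = 0 then 1 / 2 else 0)"
  by (simp add: lazy_uniform_pmf_def pmf_bind)

lemma integral_lazy_uniform_letter_character:
  assumes \<eta>: "letter_character (\<eta> :: 'a::{finite,ab_group_add} \<Rightarrow> complex)" "\<eta> \<noteq> (\<lambda>_. 1)"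
  shows "(\<integral>a. \<eta> a \<partial>measure_pmf lazy_uniform_pmf) = 1 / 2"
proof -
  have "(\<integral>a. \<eta> a \<partial>measure_pmf lazy_uniform_pmf) = (\<Sum>a\<in>UNIV. pmf lazy_uniform_pmf a *\<^sub>R \<eta> a)"
    by (rule integral_measure_pmf) auto
  also have "\<dots> = (\<Sum>a\<in>UNIV. (1 / 2 * (1 / of_nat CARD('a))) * \<eta> a + (if a = 0 then 1 / 2 * \<eta> a else 0))"
    by (intro sum.cong refl) (auto simp: pmf_lazy_uniform scaleR_conv_of_real algebra_simps)
  also have "\<dots> = 1 / 2 * \<eta> 0"
    by (subst sum.distrib, subst sum_distrib_left[symmetric]) (simp add: sum_letter_character[OF \<eta>])
  finally show ?thesis using letter_character_0[OF \<eta>(1)] by simp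
qed

section \<open>The product measure and its mixing\<close>

abbreviation lazy_product :: "(int \<Rightarrow> 'a::{finite,zero}) measure" where
  "lazy_product \<equiv> PiM UNIV (\<lambda>_. measure_pmf lazy_uniform_pmf)"

text \<open>The identity map carries the measure from the product sigma-algebra to
  \<open>config_borel\<close>, as \<open>config_prob\<close> demands.\<close>

definition lazy_config :: "(int \<Rightarrow> 'a::{finite,zero}) measure" where
  "lazy_config = distr lazy_product config_borel (\<lambda>x. x)"

text \<open>For a finite alphabet the index set of pairs is countable, so this puts every open set
  into the product sigma-algebra.\<close>

lemma openin_config_eq_Union_cylinders:
  assumes "openin config_topology (U :: (int \<Rightarrow> 'a) set)"
  shows "U = (\<Union>(m, u) \<in> {(m, u). cylinder (- int m) u \<subseteq> U}. cylinder (- int m) u)"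
proof (intro equalityI subsetI)
  fix x assume "x \<in> U"
  then obtain X where X: "x \<in> Pi\<^sub>E UNIV X" "finite {i. X i \<noteq> (UNIV :: 'a set)}" "Pi\<^sub>E UNIV X \<subseteq> U"
    using product_topology_open_contains_basis[of "\<lambda>_. discrete_topology UNIV" UNIV U x] assms
    unfolding config_topology_def by auto
  obtain m where m: "\<And>i. X i \<noteq> UNIV \<Longrightarrow> \<bar>i\<bar> \<le> int m"
  proof -
    have "finite ((\<lambda>i. nat \<bar>i\<bar>) ` {i. X i \<noteq> UNIV})" using X(2) by simp
    then obtain m where "\<forall>y\<in>(\<lambda>i. nat \<bar>i\<bar>) ` {i. X i \<noteq> UNIV}. y \<le> m"
      by (meson finite_nat_set_iff_bounded_le)
    then show thesis by (intro that[of m]) auto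
  qed
  \<comment> \<open>The sites from \<open>-m\<close> to \<open>m\<close>, which include every
    constrained coordinate, number \<open>2 * m + 1\<close>.\<close>
  define u where "u = map (\<lambda>i. x (- int m + int i)) [0..<2 * m + 1]"
  have "y \<in> U" if y: "y \<in> cylinder (- int m) u" for y
  proof -
    have "y i \<in> X i" for i
    proof (cases "X i = UNIV")
      case False
      then have "nat (i + int m) < 2 * m + 1" "- int m + int (nat (i + int m)) = i"
        using m[of i] by auto
      then have "y i = x i"
        using y by (force simp: cylinder_def u_def simp del: upt_Suc)
      then show ?thesis using X(1) by auto
    qed simp
    then show "y \<in> U" using X(3) by auto
  qed
  moreover have "x \<in> cylinder (- int m) u"
    by (simp add: cylinder_def u_def del: upt_Suc)
  ultimately show "x \<in> (\<Union>(m, u) \<in> {(m, u). cylinder (- int m) u \<subseteq> U}. cylinder (- int m) u)"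
    by blast
qed auto

lemma lazy_product_measurable_id:
  "(\<lambda>x. x) \<in> lazy_product \<rightarrow>\<^sub>M (config_borel :: (int \<Rightarrow> 'a::{finite,zero}) measure)"
proof -
  let ?P = "lazy_product :: (int \<Rightarrow> 'a) measure"
  have space: "space ?P = UNIV" by (simp add: space_PiM)
  have cyl: "cylinder k u \<in> sets ?P" for k :: int and u
  proof -
    have "{x \<in> space ?P. x (k + int i) = u ! i} \<in> sets ?P" for i
      using measurable_sets[OF measurable_component_singleton[of "k + int i" UNIV "\<lambda>_. measure_pmf lazy_uniform_pmf"],
          of "{u ! i}"]
      by (auto simp: vimage_def space)
    then have "{x \<in> space ?P. \<forall>i\<in>{..<length u}. x (k + int i) = u ! i} \<in> sets ?P"
      by (intro sets.sets_Collect_finite_All) auto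
    then show ?thesis by (simp add: cylinder_def Ball_def space)
  qed
  have "U \<in> sets ?P" if "openin config_topology U" for U :: "(int \<Rightarrow> 'a) set"
    by (subst openin_config_eq_Union_cylinders[OF that])
      (intro sets.countable_UN', auto intro: cyl)
  then show ?thesis
    unfolding config_borel_def by (intro measurable_measure_of) (auto simp: space)
qed

lemma config_prob_lazy: "config_prob (lazy_config :: (int \<Rightarrow> 'a::{finite,zero}) measure)"
  unfolding config_prob_def lazy_config_def
  by (auto intro!: prob_space.prob_space_distr prob_space_PiM prob_space_measure_pmf lazy_product_measurable_id)

text \<open>Independence factors the integral over the finite set \<open>S\<close>, and each
  nontrivial factor has mean 1/2.\<close>

lemma integral_lazy_prod:
  fixes \<phi> :: "int \<Rightarrow> 'a::{finite,ab_group_add} \<Rightarrow> complex"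
  assumes S: "finite S" and \<phi>: "\<And>k. k \<in> S \<Longrightarrow> letter_character (\<phi> k)"
    "\<And>k. k \<in> S \<Longrightarrow> \<phi> k \<noteq> (\<lambda>_. 1)"
  shows "(\<integral>x. (\<Prod>k\<in>S. \<phi> k (x k)) \<partial>lazy_config) = (1 / 2) ^ card S"
proof -
  let ?M = "\<lambda>_::int. measure_pmf (lazy_uniform_pmf :: 'a pmf)"
  interpret product_prob_space ?M UNIV
    by (rule product_prob_spaceI) (rule prob_space_measure_pmf)
  have "(\<integral>x. (\<Prod>k\<in>S. \<phi> k (x k)) \<partial>lazy_config) = (\<integral>x. (\<Prod>k\<in>S. \<phi> k (x k)) \<partial>PiM UNIV ?M)"
    unfolding lazy_config_def
    using config_character_measurable[OF config_character_prod[OF S \<phi>(1)]] lazy_product_measurable_id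
    by (intro integral_distr) auto
  also have "\<dots> = (\<integral>x. (\<Prod>k\<in>S. \<phi> k (restrict x S k)) \<partial>PiM UNIV ?M)"
    by (intro Bochner_Integration.integral_cong prod.cong) auto
  also have "\<dots> = (\<integral>x. (\<Prod>k\<in>S. \<phi> k (x k)) \<partial>distr (PiM UNIV ?M) (PiM S ?M) (\<lambda>x. restrict x S))"
  proof (rule integral_distr[symmetric])
    show "(\<lambda>x. restrict x S) \<in> PiM UNIV ?M \<rightarrow>\<^sub>M PiM S ?M"
      by (rule measurable_restrict_subset) simp
    show "(\<lambda>x. \<Prod>k\<in>S. \<phi> k (x k)) \<in> borel_measurable (PiM S ?M)"
      by (intro borel_measurable_prod measurable_compose[OF measurable_component_singleton]) auto
  qed
  also have "\<dots> = (\<integral>x. (\<Prod>k\<in>S. \<phi> k (x k)) \<partial>PiM S ?M)"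
    using S by (simp add: distr_PiM_restrict_finite)
  also have "\<dots> = (\<Prod>k\<in>S. \<integral>a. \<phi> k a \<partial>measure_pmf lazy_uniform_pmf)"
    using S by (intro product_integral_prod) (auto intro: integrable_measure_pmf_finite)
  also have "\<dots> = (1 / 2) ^ card S"
    using \<phi> by (simp add: integral_lazy_uniform_letter_character)
  finally show ?thesis .
qed

lemma harmonically_mixing_lazy:
  "harmonically_mixing (lazy_config :: (int \<Rightarrow> 'a::{finite,ab_group_add}) measure)"
  unfolding harmonically_mixing_def
proof (intro allI impI)
  fix \<epsilon> :: real assume "\<epsilon> > 0"
  then obtain N where N: "(1 / 2 :: real) ^ N < \<epsilon>"
    using real_arch_pow_inv[of \<epsilon> "1 / 2"] by auto
  \<comment> \<open>The integral is \<open>(1 / 2) ^ character_rank \<xi>\<close>. The threshold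
    \<open>Suc N\<close> is positive even for \<open>N = 0\<close>.\<close>
  have "cmod (\<integral>x. \<xi> x \<partial>lazy_config) < \<epsilon>"
    if \<xi>: "config_character \<xi>" and rank: "real (character_rank \<xi>) > real (Suc N)"
    for \<xi> :: "(int \<Rightarrow> 'a) \<Rightarrow> complex"
  proof -
    define \<phi> where "\<phi> = (THE \<phi>. character_factors \<xi> \<phi>)"
    have "character_factors \<xi> \<phi>"
      unfolding \<phi>_def by (rule theI'[OF config_character_ex1_factors[OF \<xi>]])
    then have \<phi>: "\<And>k. letter_character (\<phi> k)" "finite (character_support \<phi>)"
      "\<xi> = (\<lambda>x. \<Prod>k\<in>character_support \<phi>. \<phi> k (x k))"
      by (auto simp: character_factors_def)
    have "(\<integral>x. \<xi> x \<partial>lazy_config) = (1 / 2) ^ character_rank \<xi>"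
      unfolding character_rank_def \<phi>_def[symmetric]
      by (subst \<phi>(3), rule integral_lazy_prod) (use \<phi> in \<open>auto simp: character_support_def\<close>)
    then have "cmod (\<integral>x. \<xi> x \<partial>lazy_config) = (1 / 2) ^ character_rank \<xi>"
      by (simp add: norm_power norm_divide)
    also have "\<dots> \<le> (1 / 2) ^ N"
      using rank by (intro power_decreasing) auto
    finally show ?thesis using N by simp
  qed
  then show "\<exists>R>0. \<forall>\<xi> :: (int \<Rightarrow> 'a) \<Rightarrow> complex. config_character \<xi> \<longrightarrow>
      real (character_rank \<xi>) > R \<longrightarrow> cmod (\<integral>x. \<xi> x \<partial>lazy_config) < \<epsilon>"
    by (intro exI[of _ "real (Suc N)"]) auto
qed

text \<open>In one step the first component at \<open>z + n\<close> enters once through the rule at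
  \<open>z\<close>, with a minus sign, and once as the new second component at \<open>z + n\<close>.
  The two cancel, leaving the negative of the same expression at \<open>z - n\<close>.\<close>

lemma I_CA_soliton:
  "fst ((I_CA n ^^ t) c z) + snd ((I_CA n ^^ t) c (z + int n))
    = alternate t (fst (c (z - int n * int t)) + snd (c (z - int n * int t + int n)))"
proof (induction t arbitrary: z)
  case 0
  show ?case by (simp add: alternate_def)
next
  case (Suc t)
  have "fst ((I_CA n ^^ Suc t) c z) + snd ((I_CA n ^^ Suc t) c (z + int n))
      = - (fst ((I_CA n ^^ t) c (z - int n)) + snd ((I_CA n ^^ t) c (z - int n + int n)))"
    by (simp, subst (1 2) I_CA_def) simp
  also have "\<dots> = - alternate t (fst (c (z - int n - int n * int t)) + snd (c (z - int n - int n * int t + int n)))"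
    unfolding Suc.IH ..
  also have "\<dots> = alternate (Suc t) (fst (c (z - int n * int (Suc t))) + snd (c (z - int n * int (Suc t) + int n)))"
    by (simp add: alternate_def algebra_simps)
  finally show ?case .
qed

text \<open>The soliton at time \<open>t\<close> is, up to sign, a sum of components at two initial
  sites. They are distinct as \<open>n \<ge> 1\<close>, so each contributes an independent factor
  1/2.\<close>

lemma integral_lazy_soliton:
  fixes \<eta> :: "'g::{finite,ab_group_add} \<Rightarrow> complex"
  assumes n: "n \<ge> 1" and \<eta>: "letter_character \<eta>" "\<eta> \<noteq> (\<lambda>_. 1)"
  shows "(\<integral>c. \<eta> (fst ((I_CA n ^^ t) c 0) + snd ((I_CA n ^^ t) c (int n))) \<partial>lazy_config) = 1 / 4"
proof -
  define w where "w = - (int n * int t)"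
  \<comment> \<open>The sign of the soliton is absorbed into the character.\<close>
  define \<psi> where "\<psi> = \<eta> \<circ> alternate t"
  have add: "\<psi> (a + b) = \<psi> a * \<psi> b" for a b
    unfolding \<psi>_def o_def letter_character_add[OF \<eta>(1), symmetric] by (simp add: alternate_def)
  have norm: "cmod (\<psi> a) = 1" for a
    by (simp add: \<psi>_def letter_character_norm[OF \<eta>(1)])
  obtain b where "\<eta> b \<noteq> 1" using \<eta>(2) by blast
  then have b: "\<psi> (alternate t b) \<noteq> 1" by (simp add: \<psi>_def alternate_def)
  have \<psi>0: "\<psi> 0 = 1"
    using letter_character_0[OF \<eta>(1)] by (simp add: \<psi>_def alternate_def)
  define \<phi> :: "int \<Rightarrow> 'g \<times> 'g \<Rightarrow> complex" where "\<phi> k = (if k = w then \<psi> \<circ> fst else \<psi> \<circ> snd)" for k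
  have \<phi>: "letter_character (\<phi> k)" for k
    using norm by (auto simp: letter_character_def \<phi>_def add)
  have nt: "\<phi> k \<noteq> (\<lambda>_. 1)" for k
  proof -
    have "\<phi> k (alternate t b, alternate t b) \<noteq> 1" using b by (simp add: \<phi>_def)
    then show ?thesis by metis
  qed
  have "\<eta> (fst ((I_CA n ^^ t) c 0) + snd ((I_CA n ^^ t) c (int n)))
      = (\<Prod>k\<in>{w, w + int n}. \<phi> k (c k))" for c
    using I_CA_soliton[of t n c 0] n by (simp add: w_def[symmetric] \<phi>_def add[symmetric]) (simp add: \<psi>_def)
  then show ?thesis
    using integral_lazy_prod[of "{w, w + int n}" \<phi>] \<phi> nt n by (simp add: power2_eq_square)
qed

text \<open>The soliton has mean 0 on uniform words: adding \<open>(b, 0)\<close> to the first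
  letter permutes the words and multiplies the sum by \<open>\<eta> b\<close>. As
  \<open>n \<ge> 1\<close>, the letter at index \<open>n\<close> is unaffected.\<close>

lemma sum_letter_character_words:
  fixes \<eta> :: "'g::{finite,ab_group_add} \<Rightarrow> complex"
  assumes n: "n \<ge> 1" and \<eta>: "letter_character \<eta>" "\<eta> \<noteq> (\<lambda>_. 1)"
  shows "(\<Sum>u | length u = n + 1. \<eta> (fst (u ! 0) + snd (u ! n))) = 0"
proof -
  obtain b where b: "\<eta> b \<noteq> 1" using \<eta>(2) by blast
  let ?L = "{u :: ('g \<times> 'g) list. length u = n + 1}"
  have "(\<Sum>u\<in>?L. \<eta> (fst (u ! 0) + snd (u ! n))) = (\<Sum>u\<in>?L. \<eta> b * \<eta> (fst (u ! 0) + snd (u ! n)))"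
  proof (rule sum.reindex_bij_witness[of _ "\<lambda>u. u[0 := u ! 0 + (b, 0)]" "\<lambda>u. u[0 := u ! 0 - (b, 0)]"])
    fix u :: "('g \<times> 'g) list" assume "u \<in> ?L"
    then show "\<eta> b * \<eta> (fst (u[0 := u ! 0 - (b, 0)] ! 0) + snd (u[0 := u ! 0 - (b, 0)] ! n))
        = \<eta> (fst (u ! 0) + snd (u ! n))"
      using n by (simp add: letter_character_add[OF \<eta>(1), symmetric])
  qed auto
  then show ?thesis using b by (simp flip: sum_distrib_left)
qed

text \<open>Randomization would drive the mean of the soliton character to its uniform value 0,
  while under \<open>lazy_config\<close> it equals 1/4 at all times.\<close>

lemma not_randomizes_cylinders_I_CA:
  assumes card: "CARD('g::{finite,ab_group_add}) \<ge> 2" and n: "n \<ge> 1"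
  shows "\<not> randomizes_cylinders (I_CA n :: (int \<Rightarrow> 'g \<times> 'g) \<Rightarrow> (int \<Rightarrow> 'g \<times> 'g)) (n + 1)"
proof
  assume rand: "randomizes_cylinders (I_CA n :: (int \<Rightarrow> 'g \<times> 'g) \<Rightarrow> (int \<Rightarrow> 'g \<times> 'g)) (n + 1)"
  have "\<not> (UNIV :: 'g set) \<subseteq> {0}"
    using card card_mono[of "{0 :: 'g}" UNIV] by auto
  then obtain x :: 'g where "x \<noteq> 0" by blast
  then obtain \<eta> :: "'g \<Rightarrow> complex" where \<eta>: "letter_character \<eta>" "\<eta> x \<noteq> 1"
    by (rule letter_characters_separate)
  then have nt: "\<eta> \<noteq> (\<lambda>_. 1)" by auto
  let ?L = "{u :: ('g \<times> 'g) list. length u = n + 1}"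
  let ?\<nu> = "\<lambda>t. distr (lazy_config :: (int \<Rightarrow> 'g \<times> 'g) measure) config_borel (I_CA n ^^ t)"
  define g where "g u = \<eta> (fst (u ! 0) + snd (u ! n))" for u :: "('g \<times> 'g) list"
  define f where "f c = \<eta> (fst (c 0) + snd (c (int n)))" for c :: "int \<Rightarrow> 'g \<times> 'g"
  have finL: "finite ?L"
    using finite_lists_length_eq[of "UNIV :: ('g \<times> 'g) set" "n + 1"] by simp
  \<comment> \<open>The soliton spans sites 0 to \<open>n\<close>, so \<open>f\<close> is a finite
    combination of indicators of cylinders of length \<open>n + 1\<close>, and its mean is
    determined by their probabilities.\<close>
  have f: "f c = (\<Sum>u\<in>?L. g u * indicator (cylinder 0 u) c)" for c
  proof -
    define v where "v = map (\<lambda>i. c (int i)) [0..<n + 1]"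
    have v: "length v = n + 1" "g v = f c"
      by (auto simp: v_def g_def f_def simp del: upt_Suc)
    have "c \<in> cylinder 0 u \<longleftrightarrow> u = v" if "u \<in> ?L" for u
      using that by (auto simp: cylinder_def v_def list_eq_iff_nth_eq simp del: upt_Suc)
    then have "(\<Sum>u\<in>?L. g u * indicator (cylinder 0 u) c) = (\<Sum>u\<in>?L. if u = v then g u else 0)"
      by (intro sum.cong refl) (simp add: indicator_def)
    also have "\<dots> = f c"
      using finL v by (simp add: sum.delta)
    finally show ?thesis ..
  qed
  have const: "1 / 4 = (\<Sum>u\<in>?L. g u * of_real (measure (?\<nu> t) (cylinder 0 u)))" for t
  proof -
    have \<nu>: "config_prob (?\<nu> t)" by (rule config_prob_distr[OF config_prob_lazy])
    have "f \<in> borel_measurable config_borel"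
      unfolding f using cylinder_in_sets by measurable
    then have "(\<integral>c. f c \<partial>?\<nu> t) = (\<integral>c. f ((I_CA n ^^ t) c) \<partial>lazy_config)"
      by (rule integral_distr_I_CA[OF config_prob_lazy])
    also have "\<dots> = 1 / 4"
      unfolding f_def by (rule integral_lazy_soliton[OF n \<eta>(1) nt])
    finally have "1 / 4 = (\<integral>c. f c \<partial>?\<nu> t)" ..
    also have "\<dots> = (\<Sum>u\<in>?L. g u * of_real (measure (?\<nu> t) (cylinder 0 u)))"
      unfolding f using integral_indicator_cylinder[OF \<nu>] by (simp add: Bochner_Integration.integral_sum)
    finally show ?thesis .
  qed
  have "(\<lambda>t. \<Sum>u\<in>?L. g u * of_real (measure (?\<nu> t) (cylinder 0 u)))
      \<longlonglongrightarrow> (\<Sum>u\<in>?L. g u * of_real (1 / real CARD('g \<times> 'g) ^ (n + 1)))"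
    using rand config_prob_lazy harmonically_mixing_lazy
    unfolding randomizes_cylinders_def by (intro tendsto_intros) auto
  also have "(\<Sum>u\<in>?L. g u * of_real (1 / real CARD('g \<times> 'g) ^ (n + 1))) = 0"
    using sum_letter_character_words[OF n \<eta>(1) nt] by (simp only: g_def mult_zero_left flip: sum_distrib_right)
  finally have "(\<lambda>t. 1 / 4 :: complex) \<longlonglongrightarrow> 0" unfolding const[symmetric] .
  then show False by (simp add: LIMSEQ_const_iff)
qed

theorem theorem5:
  fixes n :: nat
  assumes "CARD('g::{finite,ab_group_add}) \<ge> 2" and "n \<ge> 1"
  shows "randomizes_cylinders (I_CA n :: (int \<Rightarrow> 'g \<times> 'g) \<Rightarrow> (int \<Rightarrow> 'g \<times> 'g)) n \<and>
         \<not> randomizes_cylinders (I_CA n :: (int \<Rightarrow> 'g \<times> 'g) \<Rightarrow> (int \<Rightarrow> 'g \<times> 'g)) (n + 1)"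
  using randomizes_cylinders_I_CA not_randomizes_cylinders_I_CA assms by blast

end
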